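(* For every $\varepsilon>0$, the Strategy problem (of size $n$) does not admit a deterministic two-party communication protocol using $O\left(\log^{1-\varepsilon} n\right)$ rounds and $O(\log n)$ bits of communication in each round.
   Context: Strategy problem of size $n$: Let $T$ be a full binary tree with $n$ vertices, with the root at depth $0$. A function $f$ assigns to each vertex of $T$ a value in $\{0,1\}$. Alice knows the values of $f$ at the vertices of odd depth, and Bob knows the values of $f$ at the vertices of even depth. The leaf reached by $f$ is the endpoint of the path that starts at the root and always moves from a vertex $v$ to its left son if $f(v)=0$ and to its right son otherwise. The players must determine the index of the leaf reached by $f$. A round of a deterministic protocol is a maximal consecutive sequence of bits sent by the same player. *)

theory Defs
  imports Complex_Main "HOL-Library.FuncSet" "HOL-Library.Landau_Symbols"
begin

section \<open>Deterministic two-party protocols\<close>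

datatype player = Alice | Bob

text \<open>
  Protocol trees: \<^verbatim>\<open>Send_Alice q P0 P1\<close> is a vertex at which Alice, holding input \<^verbatim>\<open>x\<close>,
  sends the bit \<^verbatim>\<open>q x\<close>, after which the protocol continues with \<^verbatim>\<open>P0\<close> (bit 0, i.e. False) or
  \<^verbatim>\<open>P1\<close> (bit 1, i.e. True); dually for Bob. The output is a function of the transcript, so both
  players know it at the end.
\<close>

datatype ('x, 'y, 'z) protocol =
    Output 'z
  | Send_Alice "'x \<Rightarrow> bool" "('x, 'y, 'z) protocol" "('x, 'y, 'z) protocol"
  | Send_Bob "'y \<Rightarrow> bool" "('x, 'y, 'z) protocol" "('x, 'y, 'z) protocol"

primrec protocol_output :: "('x, 'y, 'z) protocol \<Rightarrow> 'x \<Rightarrow> 'y \<Rightarrow> 'z" where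
  "protocol_output (Output z) x y = z"
| "protocol_output (Send_Alice q P0 P1) x y =
     (if q x then protocol_output P1 x y else protocol_output P0 x y)"
| "protocol_output (Send_Bob q P0 P1) x y =
     (if q y then protocol_output P1 x y else protocol_output P0 x y)"

primrec transcript :: "('x, 'y, 'z) protocol \<Rightarrow> 'x \<Rightarrow> 'y \<Rightarrow> (player \<times> bool) list" where
  "transcript (Output z) x y = []"
| "transcript (Send_Alice q P0 P1) x y =
     (Alice, q x) # (if q x then transcript P1 x y else transcript P0 x y)"
| "transcript (Send_Bob q P0 P1) x y =
     (Bob, q y) # (if q y then transcript P1 x y else transcript P0 x y)"

text \<open>The decomposition of a transcript into maximal blocks of bits sent by one player.\<close>

function rounds :: "(player \<times> bool) list \<Rightarrow> (player \<times> bool) list list" where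
  "rounds [] = []"
| "rounds (m # ms) =
     (m # takeWhile (\<lambda>m'. fst m' = fst m) ms) # rounds (dropWhile (\<lambda>m'. fst m' = fst m) ms)"
  by pat_completeness auto
termination
  by (relation "measure length") (simp_all add: le_imp_less_Suc length_dropWhile_le)


section \<open>The Strategy problem\<close>

text \<open>
  A vertex of the full binary tree of height \<^verbatim>\<open>d\<close> is identified with the sequence of turns leading
  to it from the root: the root is \<^verbatim>\<open>[]\<close>, and the left and right sons of \<^verbatim>\<open>v\<close> are \<^verbatim>\<open>v @ [False]\<close>
  and \<^verbatim>\<open>v @ [True]\<close>. Its depth is its length, and the leaves are the vertices of depth \<^verbatim>\<open>d\<close>.
\<close>

definition vertices :: "nat \<Rightarrow> bool list set" where
  "vertices d = {v. length v \<le> d}"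

definition tree_size :: "nat \<Rightarrow> nat" where
  "tree_size d = card (vertices d)"

definition alice_view :: "nat \<Rightarrow> (bool list \<Rightarrow> bool) \<Rightarrow> bool list \<Rightarrow> bool" where
  "alice_view d f = restrict f {v \<in> vertices d. odd (length v)}"

definition bob_view :: "nat \<Rightarrow> (bool list \<Rightarrow> bool) \<Rightarrow> bool list \<Rightarrow> bool" where
  "bob_view d f = restrict f {v \<in> vertices d. even (length v)}"

primrec walk :: "(bool list \<Rightarrow> bool) \<Rightarrow> nat \<Rightarrow> bool list" where
  "walk f 0 = []"
| "walk f (Suc k) = walk f k @ [f (walk f k)]"

text \<open>
  Leaves are indexed from left to right, starting at 0. The most significant binary digit of the
  index is the first turn, whereas \<^const>\<open>horner_sum\<close> expects the least significant digit first.
\<close>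

definition leaf_index :: "bool list \<Rightarrow> nat" where
  "leaf_index v = horner_sum of_bool 2 (rev v)"

definition reached_index :: "nat \<Rightarrow> (bool list \<Rightarrow> bool) \<Rightarrow> nat" where
  "reached_index d f = leaf_index (walk f d)"

type_synonym strategy_protocol = "(bool list \<Rightarrow> bool, bool list \<Rightarrow> bool, nat) protocol"

definition solves_strategy :: "nat \<Rightarrow> strategy_protocol \<Rightarrow> bool" where
  "solves_strategy d P \<longleftrightarrow>
     (\<forall>f. protocol_output P (alice_view d f) (bob_view d f) = reached_index d f)"

definition strategy_rounds ::
    "nat \<Rightarrow> strategy_protocol \<Rightarrow> (bool list \<Rightarrow> bool) \<Rightarrow> (player \<times> bool) list list" where
  "strategy_rounds d P f = rounds (transcript P (alice_view d f) (bob_view d f))"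

lemma tree_size_eq: "tree_size d = 2 ^ (d + 1) - 1"
proof -
  have "card (vertices d) = (\<Sum>i\<le>d. 2 ^ i)"
    using card_lists_length_le[of "UNIV :: bool set" d] by (simp add: vertices_def)
  also have "\<dots> = 2 ^ (d + 1) - 1"
    by (induction d) auto
  finally show ?thesis
    by (simp add: tree_size_def)
qed

lemma bij_betw_leaf_index: "bij_betw leaf_index {v. length v = d} {..<2 ^ d}"
proof -
  have horner_inj: "xs = ys" if "length xs = length ys"
    "horner_sum of_bool (2 :: nat) xs = horner_sum of_bool 2 ys" for xs ys
    using that
  proof (induction xs ys rule: list_induct2)
    case (Cons x xs y ys)
    have "x = y"
      using arg_cong[OF Cons.prems, of even] by (cases x; cases y) simp_all
    with Cons show ?case by simp
  qed simp
  have inj: "inj_on leaf_index {v. length v = d}"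
    using horner_inj[of "rev v" "rev w" for v w] by (auto simp: inj_on_def leaf_index_def)
  have "horner_sum of_bool (2 :: nat) xs < 2 ^ length xs" for xs
    by (induction xs) auto
  then have "leaf_index v < 2 ^ length v" for v
    unfolding leaf_index_def by (metis length_rev)
  then have sub: "leaf_index ` {v. length v = d} \<subseteq> {..<2 ^ d}"
    by auto
  have "card {v :: bool list. length v = d} = 2 ^ d"
    using card_lists_length_eq[of "UNIV :: bool set" d] by simp
  with inj sub show ?thesis
    by (simp add: bij_betw_def card_image card_subset_eq)
qed

end

theory Submission
  imports Defs "HOL-Real_Asymp.Real_Asymp"
begin

text \<open>
  Round elimination. Grouping the levels of the binary tree into blocks of odd length \<^verbatim>\<open>2 * L + 1\<close> turns
  the Strategy problem into pointer jumping on a tree of degree \<^verbatim>\<open>2 ^ Suc L\<close> whose levels alternate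
  between the players. Suppose that the owner of the root and the other player hold inputs from dense
  sets, and that the other player speaks first. A message of few bits leaves that player a set whose
  projections to nearly all of the subtrees below the root are still dense; the owner's pointer can be
  fixed to one of these while keeping the owner's set dense in that subtree. So one level of the tree
  absorbs one round, with hardly any loss of density, if the degree exceeds the message length times
  the square of the number of rounds. Hence a degree polynomial in the depth suffices, and any protocol
  needs at least of the order of depth / log depth rounds.
\<close>

section \<open>Pointer games on trees\<close>

text \<open>One type serves both players because they exchange roles at every level: the owner of a
  vertex does not own its sons.\<close>

datatype input = Leaf | Node (pointer: "bool list") (child: "bool list \<Rightarrow> input")

definition index :: "nat \<Rightarrow> bool list set" where
  "index L = {w. length w = Suc L}"

text \<open>A player who does not own the root carries an all-\<open>False\<close> dummy pointer
  there, which will later mean always turning left.\<close>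

fun owner_inputs other_inputs :: "nat \<Rightarrow> nat \<Rightarrow> input set" where
  "owner_inputs L 0 = {Leaf}"
| "owner_inputs L (Suc k) =
     (\<lambda>(p, c). Node p c) ` (index L \<times> (index L \<rightarrow>\<^sub>E other_inputs L k))"
| "other_inputs L 0 = {Leaf}"
| "other_inputs L (Suc k) =
     Node (replicate (Suc L) False) ` (index L \<rightarrow>\<^sub>E owner_inputs L k)"

text \<open>The arguments swap in the recursive call because the other player owns the son.
  Recording the whole path makes the play in a subtree the tail of the full play.\<close>

primrec play :: "nat \<Rightarrow> input \<Rightarrow> input \<Rightarrow> bool list list" where
  "play 0 x y = []"
| "play (Suc k) x y = pointer x # play k (child y (pointer x)) (child x (pointer x))"

lemma finite_index [simp]: "finite (index L)"
  using finite_lists_length_eq[of "UNIV :: bool set" "Suc L"] by (simp add: index_def)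

lemma card_index: "card (index L) = 2 ^ Suc L"
  using card_lists_length_eq[of "UNIV :: bool set" "Suc L"] by (simp add: index_def)

lemma index_nonempty: "index L \<noteq> {}"
  using card_index[of L] by force

lemma finite_inputs:
  "finite (owner_inputs L k)" "finite (other_inputs L k)"
  by (induction k) (auto intro!: finite_PiE finite_imageI)

lemma inputs_nonempty:
  "owner_inputs L k \<noteq> {}" "other_inputs L k \<noteq> {}"
  by (induction k) (auto simp: PiE_eq_empty_iff index_nonempty)

lemma card_owner_inputs_Suc:
  "card (owner_inputs L (Suc k)) = 2 ^ Suc L * card (other_inputs L k) ^ card (index L)"
proof -
  have "inj_on (\<lambda>(p, c). Node p c) S" for S
    by (auto simp: inj_on_def)
  then show ?thesis
    by (simp only: owner_inputs.simps card_image)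
       (simp add: card_cartesian_product card_PiE card_index)
qed

lemma card_other_inputs_Suc:
  "card (other_inputs L (Suc k)) = card (owner_inputs L k) ^ card (index L)"
  by (simp add: card_image card_PiE inj_on_def)

lemma owner_inputs_SucD:
  assumes "x \<in> owner_inputs L (Suc k)"
  shows "x = Node (pointer x) (child x)" "pointer x \<in> index L"
    "child x \<in> index L \<rightarrow>\<^sub>E other_inputs L k"
  using assms by auto

lemma other_inputs_SucD:
  assumes "y \<in> other_inputs L (Suc k)"
  shows "y = Node (replicate (Suc L) False) (child y)"
    "child y \<in> index L \<rightarrow>\<^sub>E owner_inputs L k"
  using assms by auto


section \<open>Communication in alternating rounds\<close>

text \<open>The holder of the second argument speaks first; the roles swap after every round.\<close>

primrec easy :: "nat \<Rightarrow> nat \<Rightarrow> 'a set \<Rightarrow> 'a set \<Rightarrow> ('a \<Rightarrow> 'a \<Rightarrow> 'z) \<Rightarrow> bool" where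
  "easy b 0 X Y g \<longleftrightarrow> (\<exists>z. \<forall>x\<in>X. \<forall>y\<in>Y. g x y = z)"
| "easy b (Suc r) X Y g \<longleftrightarrow>
     (\<exists>msg :: 'a \<Rightarrow> bool list. (\<forall>y\<in>Y. length (msg y) \<le> b) \<and>
       (\<forall>m. easy b r {y \<in> Y. msg y = m} X (\<lambda>y x. g x y)))"

lemma easy_const: "(\<And>x y. x \<in> X \<Longrightarrow> y \<in> Y \<Longrightarrow> g x y = z) \<Longrightarrow> easy b r X Y g"
proof (induction r arbitrary: X Y g)
  case (Suc r)
  show ?case
    by (auto intro!: exI[of _ "\<lambda>_. []"] Suc)
qed auto

text \<open>Reductions cost no communication: the players translate their inputs by \<phi> and
  \<psi>, run the given protocol and apply \<open>h\<close> to its result.\<close>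

lemma easy_pullback:
  assumes "easy b r X Y g"
    and "\<And>x. x \<in> X' \<Longrightarrow> \<phi> x \<in> X" and "\<And>y. y \<in> Y' \<Longrightarrow> \<psi> y \<in> Y"
    and "\<And>x y. x \<in> X' \<Longrightarrow> y \<in> Y' \<Longrightarrow> g' x y = h (g (\<phi> x) (\<psi> y))"
  shows "easy b r X' Y' g'"
  using assms
proof (induction r arbitrary: X Y g X' Y' g' \<phi> \<psi>)
  case 0
  then obtain z where "\<forall>x\<in>X. \<forall>y\<in>Y. g x y = z"
    by auto
  with 0 show ?case
    by auto
next
  case (Suc r)
  then obtain msg :: "'a \<Rightarrow> bool list" where msg: "\<forall>y\<in>Y. length (msg y) \<le> b"
    "\<And>m. easy b r {y \<in> Y. msg y = m} X (\<lambda>y x. g x y)"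
    by auto
  have "easy b r {y \<in> Y'. msg (\<psi> y) = m} X' (\<lambda>y x. g' x y)" for m
    by (rule Suc.IH[OF msg(2), of _ \<psi> m _ \<phi>]) (use Suc.prems in auto)
  with msg(1) Suc.prems(3) show ?case
    by (auto intro!: exI[of _ "msg \<circ> \<psi>"])
qed


section \<open>Round elimination\<close>

text \<open>\<open>C\<close> lies in the product of its projections, and each small projection costs
  a factor \<open>1 - \<delta>\<close>, at most \<open>exp (- \<delta>)\<close>. The total loss is
  at most \<open>2 ^ B\<close>, hence at most \<open>exp B\<close>; compare exponents.\<close>

lemma few_small_projections:
  fixes \<delta> :: real
  assumes "finite I" "finite A" "A \<noteq> {}" and C: "C \<subseteq> I \<rightarrow>\<^sub>E A"
    and dense: "card A ^ card I \<le> 2 ^ B * card C"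
    and \<delta>: "0 \<le> \<delta>" "\<delta> \<le> 1"
  shows "\<delta> * card {i \<in> I. card ((\<lambda>c. c i) ` C) < (1 - \<delta>) * card A} \<le> B"
proof -
  let ?S = "{i \<in> I. card ((\<lambda>c. c i) ` C) < (1 - \<delta>) * card A}"
  let ?p = "\<lambda>i. real (card ((\<lambda>c. c i) ` C))"
  have A: "real (card A) > 0"
    using assms by (simp add: card_gt_0_iff)
  have proj: "(\<lambda>c. c i) ` C \<subseteq> A" if "i \<in> I" for i
    using C that by auto
  have "C \<subseteq> (\<Pi>\<^sub>E i\<in>I. (\<lambda>c. c i) ` C)"
    using C by (fastforce simp: PiE_iff)
  moreover have "finite (\<Pi>\<^sub>E i\<in>I. (\<lambda>c. c i) ` C)"
    using assms(1,2) proj by (intro finite_PiE) (auto intro: finite_subset)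
  ultimately have "card C \<le> (\<Prod>i\<in>I. card ((\<lambda>c. c i) ` C))"
    using card_mono card_PiE[OF \<open>finite I\<close>] by metis
  then have "real (card C) \<le> (\<Prod>i\<in>I. ?p i)"
    by (metis of_nat_le_iff of_nat_prod)
  also have "\<dots> \<le> (\<Prod>i\<in>I. (if i \<in> ?S then 1 - \<delta> else 1) * card A)"
    using assms(2) proj by (intro prod_mono) (auto intro: card_mono)
  also have "\<dots> = (1 - \<delta>) ^ card ?S * card A ^ card I"
    using \<open>finite I\<close> by (simp add: prod.distrib prod.If_cases Int_def)
  also have "\<dots> \<le> exp (- \<delta>) ^ card ?S * card A ^ card I"
    using \<delta> exp_ge_add_one_self[of "- \<delta>"] by (intro mult_right_mono power_mono) auto
  finally have "real (card C) \<le> exp (- (\<delta> * card ?S)) * card A ^ card I"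
    by (simp flip: exp_of_nat_mult add: mult.commute)
  then have "2 ^ B * real (card C) \<le> 2 ^ B * (exp (- (\<delta> * card ?S)) * real (card A ^ card I))"
    by (intro mult_left_mono) auto
  moreover have "real (card A ^ card I) \<le> 2 ^ B * real (card C)"
    using of_nat_mono[OF dense, where 'a = real] by simp
  ultimately have "real (card A ^ card I) * 1
      \<le> real (card A ^ card I) * (2 ^ B * exp (- (\<delta> * card ?S)))"
    by (simp only: mult_ac mult_1_left)
  then have "1 \<le> 2 ^ B * exp (- (\<delta> * card ?S))"
    using A by (subst (asm) mult_le_cancel_left_pos) simp_all
  also have "\<dots> \<le> exp 1 ^ B * exp (- (\<delta> * card ?S))"
    using exp_ge_add_one_self[of 1] by (intro mult_right_mono power_mono) auto
  also have "\<dots> = exp (B - \<delta> * card ?S)"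
    by (simp flip: exp_of_nat_mult exp_add)
  finally show ?thesis
    by simp
qed

text \<open>Once the pointer is \<open>i\<close>, the value at \<open>i\<close> lies in the
  projection of the fibre and each of the other values has at most \<open>card A\<close> choices.
  Summing over \<open>i\<close> gives the bound.\<close>

lemma card_le_pointed_projections:
  assumes "finite I" "finite A" and X: "X \<subseteq> I \<times> (I \<rightarrow>\<^sub>E A)"
  shows "card X \<le> (\<Sum>i\<in>I. card ((\<lambda>c. c i) ` (X `` {i}))) * card A ^ (card I - 1)"
proof -
  have X': "X `` {i} \<subseteq> I \<rightarrow>\<^sub>E A" for i
    using X by auto
  have fin: "finite (X `` {i})" for i
    using assms(1,2) by (intro finite_subset[OF X'] finite_PiE) auto
  have "card (X `` {i}) \<le> card ((\<lambda>c. c i) ` (X `` {i})) * card A ^ (card I - 1)"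
    if i: "i \<in> I" for i
  proof -
    let ?B = "\<lambda>j. if j = i then (\<lambda>c. c i) ` (X `` {i}) else A"
    have "X `` {i} \<subseteq> Pi\<^sub>E I ?B"
      using X' by (fastforce simp: PiE_iff)
    moreover have "finite (Pi\<^sub>E I ?B)"
      using assms(1,2) fin by (intro finite_PiE) auto
    ultimately have "card (X `` {i}) \<le> (\<Prod>j\<in>I. card (?B j))"
      using card_mono card_PiE[OF \<open>finite I\<close>] by metis
    also have "\<dots> = card (?B i) * (\<Prod>j\<in>I - {i}. card (?B j))"
      using assms(1) i by (simp add: prod.remove)
    also have "(\<Prod>j\<in>I - {i}. card (?B j)) = (\<Prod>j\<in>I - {i}. card A)"
      by (intro prod.cong) auto
    finally show ?thesis
      using assms(1) i by simp
  qed
  then have "(\<Sum>i\<in>I. card (X `` {i}))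
      \<le> (\<Sum>i\<in>I. card ((\<lambda>c. c i) ` (X `` {i})) * card A ^ (card I - 1))"
    by (rule sum_mono)
  moreover have "X = Sigma I (\<lambda>i. X `` {i})"
    using X by auto
  then have "card X = (\<Sum>i\<in>I. card (X `` {i}))"
    using assms(1) fin by (metis card_SigmaI)
  ultimately show ?thesis
    by (simp add: sum_distrib_right)
qed

lemma popular_message:
  assumes "finite Y" and msg: "\<And>y. y \<in> Y \<Longrightarrow> length (msg y :: bool list) \<le> b"
  shows "\<exists>m. card Y \<le> 2 ^ Suc b * card {y \<in> Y. msg y = m}"
proof (rule ccontr)
  assume "\<not> ?thesis"
  then have less: "2 ^ Suc b * card {y \<in> Y. msg y = m} < card Y" for m
    by (meson not_le)
  \<comment> \<open>\<open>vertices b\<close> is reused as the set of all possible messages: there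
    are fewer than \<open>2 ^ Suc b\<close> bit strings of length at most \<open>b\<close>, so the
    pigeonhole principle applies.\<close>
  let ?M = "vertices b"
  have M: "card ?M = 2 ^ Suc b - 1"
    using tree_size_eq[of b] by (simp add: tree_size_def)
  have "finite ?M"
    using finite_lists_length_le[of "UNIV :: bool set" b] by (simp add: vertices_def)
  moreover have "msg ` Y \<subseteq> ?M"
    using msg by (auto simp: vertices_def)
  ultimately have "card Y = (\<Sum>m\<in>?M. card {y \<in> Y. msg y = m})"
    using sum.group[of Y ?M msg "\<lambda>_. 1 :: nat"] \<open>finite Y\<close> by simp
  then have "2 ^ Suc b * card Y = (\<Sum>m\<in>?M. 2 ^ Suc b * card {y \<in> Y. msg y = m})"
    by (simp add: sum_distrib_left)
  also have "\<dots> \<le> (\<Sum>m\<in>?M. card Y)"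
    using less by (intro sum_mono less_imp_le)
  also have "\<dots> \<le> 2 ^ Suc b * card Y - card Y"
    by (simp add: M diff_mult_distrib)
  finally have "2 ^ Suc b * card Y \<le> 2 ^ Suc b * card Y - card Y" .
  moreover have "card Y > 0" "(2::nat) ^ Suc b * card Y > 0"
    using less[of "[]"] by auto
  ultimately show False
    by linarith
qed

text \<open>Induction on the rounds: each step removes one round, one level of the tree and \<delta>
  from the required density, which therefore stays at least 1/2.\<close>

theorem play_not_easy:
  fixes \<delta> :: real
  assumes "easy b r X Y (play k)" "r < k"
    and XY: "X \<subseteq> owner_inputs L k" "Y \<subseteq> other_inputs L k"
    and dense: "(1/2 + r * \<delta>) * card (owner_inputs L k) \<le> card X"
      "(1/2 + r * \<delta>) * card (other_inputs L k) \<le> card Y"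
    and \<delta>: "0 < \<delta>" "r * \<delta> \<le> 1/2" and L: "b + 2 < \<delta>\<^sup>2 * 2 ^ Suc L" "0 < L"
  shows False
  using assms
proof (induction r arbitrary: k X Y)
  case 0
  then obtain k' where k: "k = Suc k'"
    by (cases k) auto
  have "card (other_inputs L k) > 0"
    by (simp add: card_gt_0_iff finite_inputs inputs_nonempty)
  with 0(6) have "card Y \<noteq> 0"
    by (intro notI) simp
  then obtain y where "y \<in> Y"
    by fastforce
  with 0 obtain z where z: "\<And>x. x \<in> X \<Longrightarrow> play k x y = z"
    by auto
  \<comment> \<open>With no communication left, all inputs in \<open>X\<close> share the pointer
    \<open>hd z\<close>. So \<open>X\<close> has density at most \<open>1 / 2 ^ Suc L\<close>, which
    is below 1/2 as \<open>L\<close> is positive.\<close>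
  have "X \<subseteq> Node (hd z) ` (index L \<rightarrow>\<^sub>E other_inputs L k')"
  proof
    fix x assume "x \<in> X"
    with 0(3) z[OF \<open>x \<in> X\<close>] show "x \<in> Node (hd z) ` (index L \<rightarrow>\<^sub>E other_inputs L k')"
      by (auto simp: k)
  qed
  then have "card X \<le> card (index L \<rightarrow>\<^sub>E other_inputs L k')"
    by (metis card_image_le card_mono finite_PiE finite_imageI finite_index finite_inputs(2) order_trans)
  then have X: "card X \<le> card (other_inputs L k') ^ card (index L)"
    by (simp add: card_PiE)
  let ?p = "card (other_inputs L k') ^ card (index L)"
  have "?p > 0"
    using finite_inputs(2) inputs_nonempty(2) by (simp add: card_gt_0_iff)
  have "2 ^ Suc L * real ?p \<le> 2 * card X"
    using 0(5) unfolding k card_owner_inputs_Suc by simp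
  also have "\<dots> \<le> 2 * real ?p"
    using X by linarith
  finally have "(2::real) ^ Suc L \<le> 2"
    using \<open>?p > 0\<close> by (simp only: mult_le_cancel_right of_nat_0_less_iff)
  moreover have "(2::real) ^ Suc L > 2 ^ 1"
    using \<open>0 < L\<close> by (intro power_strict_increasing) auto
  ultimately show ?case
    by simp
next
  case (Suc r)
  then obtain k' where k: "k = Suc k'" "r < k'"
    by (cases k) auto
  let ?I = "index L" and ?A = "owner_inputs L k'" and ?B = "other_inputs L k'"
  \<comment> \<open>The density that has to survive this round; \<open>X\<close> and
    \<open>Y\<close> start with \<open>a + \<delta>\<close>.\<close>
  define a where "a = 1/2 + r * \<delta>"
  have a: "a + \<delta> \<le> 1" "a \<ge> 1/2" "real (Suc r) * \<delta> = r * \<delta> + \<delta>" "r * \<delta> \<ge> 0"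
    using Suc.prems(7,8) by (auto simp: a_def algebra_simps)
  have card_pos: "card ?A > 0" "card ?B > 0"
    by (simp_all add: card_gt_0_iff finite_inputs inputs_nonempty)
  have finX: "finite X" and finY: "finite Y"
    using Suc.prems(3,4) finite_inputs finite_subset by blast+
  obtain msg where msg: "\<And>y. y \<in> Y \<Longrightarrow> length (msg y :: bool list) \<le> b"
    "\<And>m. easy b r {y \<in> Y. msg y = m} X (\<lambda>y x. play k x y)"
    using Suc.prems(1) by auto
  obtain m where m: "card Y \<le> 2 ^ Suc b * card {y \<in> Y. msg y = m}"
    using popular_message[of Y msg b] finY msg(1) by blast
  define Y' where "Y' = {y \<in> Y. msg y = m}"
  define C where "C = child ` Y'"
  have C: "C \<subseteq> ?I \<rightarrow>\<^sub>E ?A"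
    using Suc.prems(4) other_inputs_SucD(2) unfolding C_def Y'_def k by blast
  have "inj_on child Y'"
    using Suc.prems(4) other_inputs_SucD(1) unfolding Y'_def k inj_on_def
    by (metis (no_types, lifting) mem_Collect_eq subsetD)
  then have card_C: "card C = card Y'"
    by (simp add: C_def card_image)
  have "1/2 * real (card (other_inputs L k)) \<le> (1/2 + Suc r * \<delta>) * card (other_inputs L k)"
    using a Suc.prems(7) by (intro mult_right_mono) auto
  then have "real (card (other_inputs L k)) \<le> 2 * real (card Y)"
    using Suc.prems(6) by linarith
  \<comment> \<open>A factor 2 pays for the density of \<open>Y\<close>, the factor
    \<open>2 ^ Suc b\<close> for fixing the popular message.\<close>
  then have "card (other_inputs L k) \<le> 2 ^ (b + 2) * card Y'"
    using m by (simp add: Y'_def)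
  then have C_dense: "card ?A ^ card ?I \<le> 2 ^ (b + 2) * card C"
    unfolding k card_other_inputs_Suc card_C .
  \<comment> \<open>The sons at which the message has revealed too much. By the assumption on
    \<open>L\<close> they make up less than a \<delta> fraction.\<close>
  define bad where "bad = {i \<in> ?I. card ((\<lambda>c. c i) ` C) < (1 - \<delta>) * card ?A}"
  have "\<delta> * card bad \<le> b + 2"
    unfolding bad_def using C C_dense a Suc.prems(7)
    by (intro few_small_projections) (auto simp: finite_inputs inputs_nonempty)
  also have "\<dots> < \<delta> * (\<delta> * card ?I)"
    using Suc.prems(9) by (simp add: card_index power2_eq_square)
  finally have bad: "card bad < \<delta> * card ?I"
    using Suc.prems(7) by simp
  define X' where "X' = (\<lambda>x. (pointer x, child x)) ` X"
  have X': "X' \<subseteq> ?I \<times> (?I \<rightarrow>\<^sub>E ?B)"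
    using Suc.prems(3) owner_inputs_SucD(2,3) unfolding X'_def k by blast
  have "inj_on (\<lambda>x. (pointer x, child x)) X"
    using Suc.prems(3) owner_inputs_SucD(1) unfolding k inj_on_def
    by (metis Pair_inject subsetD)
  then have card_X': "card X' = card X"
    by (simp add: X'_def card_image)
  define Z where "Z i = (\<lambda>c. c i) ` (X' `` {i})" for i
  have ZB: "Z i \<subseteq> ?B" if "i \<in> ?I" for i
    using X' that by (auto simp: Z_def)
  \<comment> \<open>Averaging over the pointer: the sets \<open>Z i\<close> have mean density at
    least \<open>a + \<delta>\<close>, and the bad indices contribute less than \<delta> to this
    mean. So some good index reaches \<open>a\<close>.\<close>
  have "\<exists>i\<in>?I - bad. a * card ?B \<le> card (Z i)"
  proof (rule ccontr)
    assume "\<not> ?thesis"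
    then have small: "real (card (Z i)) \<le> a * card ?B" if "i \<in> ?I - bad" for i
      using that by force
    have I: "bad \<subseteq> ?I"
      by (auto simp: bad_def)
    have "card ?I > 0"
      by (simp add: card_index)
    have "(a + \<delta>) * (card ?I * (card ?B * card ?B ^ (card ?I - 1))) \<le> card X"
      using Suc.prems(5) a \<open>card ?I > 0\<close> unfolding k card_owner_inputs_Suc a_def
      by (simp add: card_index algebra_simps flip: power_Suc)
    also have "\<dots> \<le> (\<Sum>i\<in>?I. real (card (Z i))) * card ?B ^ (card ?I - 1)"
      using of_nat_mono[OF card_le_pointed_projections[OF finite_index finite_inputs(2) X'],
          where 'a = real]
      unfolding card_X' Z_def by simp
    finally have "(a + \<delta>) * card ?I * card ?B * card ?B ^ (card ?I - 1)
        \<le> (\<Sum>i\<in>?I. real (card (Z i))) * card ?B ^ (card ?I - 1)"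
      by (simp add: mult_ac)
    then have "(a + \<delta>) * card ?I * card ?B \<le> (\<Sum>i\<in>?I. real (card (Z i)))"
      using card_pos(2) by (subst (asm) mult_le_cancel_right_pos) auto
    also have "\<dots> = (\<Sum>i\<in>?I - bad. real (card (Z i))) + (\<Sum>i\<in>bad. real (card (Z i)))"
      using I by (simp add: sum.subset_diff)
    also have "\<dots> \<le> (\<Sum>i\<in>?I - bad. a * card ?B) + (\<Sum>i\<in>bad. real (card ?B))"
      using small I ZB finite_inputs(2) by (intro add_mono sum_mono) (auto intro!: card_mono)
    also have "\<dots> \<le> (\<Sum>i\<in>?I. a * card ?B) + (\<Sum>i\<in>bad. real (card ?B))"
      using a by (intro add_mono sum_mono2) (auto simp: bad_def)
    also have "\<dots> = (a * card ?I + card bad) * card ?B"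
      by (simp add: algebra_simps)
    finally have "(a + \<delta>) * card ?I \<le> a * card ?I + card bad"
      using card_pos(2) by simp
    with bad show False
      by (simp add: algebra_simps)
  qed
  then obtain i where i: "i \<in> ?I" "i \<notin> bad" "a * card ?B \<le> card (Z i)"
    by auto
  define W where "W = (\<lambda>c. c i) ` C"
  have "a * card ?A \<le> (1 - \<delta>) * card ?A"
    using a by (intro mult_right_mono) auto
  also have "\<dots> \<le> card W"
    using i by (auto simp: bad_def W_def not_less)
  finally have W: "a * card ?A \<le> card W" .
  \<comment> \<open>Inputs for the subtree at \<open>i\<close> are lifted to full inputs; the lifts
    of the owner all point to \<open>i\<close>.\<close>
  have "\<forall>z\<in>Z i. \<exists>x\<in>X. pointer x = i \<and> child x i = z"
    by (auto simp: Z_def X'_def)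
  then obtain \<phi> where \<phi>: "\<And>z. z \<in> Z i \<Longrightarrow> \<phi> z \<in> X \<and> pointer (\<phi> z) = i \<and> child (\<phi> z) i = z"
    by metis
  have "\<forall>w\<in>W. \<exists>y\<in>Y'. child y i = w"
    by (auto simp: W_def C_def)
  then obtain \<psi> where \<psi>: "\<And>w. w \<in> W \<Longrightarrow> \<psi> w \<in> Y' \<and> child (\<psi> w) i = w"
    by metis
  have "easy b r Y' X (\<lambda>y x. play k x y)"
    using msg(2) by (simp add: Y'_def)
  \<comment> \<open>On lifted inputs the play is \<open>i\<close> followed by the play in the
    subtree, whence \<open>tl\<close>. The player who has just spoken owns the root of the subtree,
    so \<open>W\<close> comes first and the roles match again.\<close>
  then have "easy b r W (Z i) (play k')"
    by (rule easy_pullback[where \<phi> = \<psi> and \<psi> = \<phi> and h = tl]) (use \<phi> \<psi> in \<open>auto simp: k\<close>)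
  then show False
  proof (rule Suc.IH)
    show "W \<subseteq> ?A"
      using C i(1) by (auto simp: W_def)
  qed (use k ZB i W a Suc.prems in \<open>auto simp: a_def\<close>)
qed

corollary game_not_easy:
  assumes "4 * (r + 1)\<^sup>2 * (b + 2) < 2 ^ Suc L"
  shows "\<not> easy b r (owner_inputs L (Suc r)) (other_inputs L (Suc r)) (play (Suc r))"
proof
  assume easy: "easy b r (owner_inputs L (Suc r)) (other_inputs L (Suc r)) (play (Suc r))"
  have "8 \<le> 4 * (r + 1)\<^sup>2 * (b + 2)"
    using mult_le_mono[of 1 "(r + 1)\<^sup>2" 2 "b + 2"] by simp
  with assms have "0 < L"
    by (cases L) auto
  \<comment> \<open>This choice keeps \<open>1/2 + r * \<delta>\<close> at most 1, so the full input
    sets are dense enough, and turns the hypothesis into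
    \<open>b + 2 < \<delta>\<^sup>2 * 2 ^ Suc L\<close>.\<close>
  let ?\<delta> = "1 / (2 * (real r + 1))"
  have half: "1/2 + r * ?\<delta> \<le> 1" "r * ?\<delta> \<le> 1/2"
    by (auto simp: field_simps)
  have "?\<delta>\<^sup>2 = 1 / real (4 * (r + 1)\<^sup>2)"
    by (simp only: power_divide power_mult_distrib) simp
  moreover have "real (4 * (r + 1)\<^sup>2) * real (b + 2) < 2 ^ Suc L"
    using assms unfolding of_nat_mult[symmetric] by (metis of_nat_less_iff of_nat_numeral of_nat_power)
  ultimately have "b + 2 < ?\<delta>\<^sup>2 * 2 ^ Suc L"
    by (simp only: times_divide_eq_left mult_1_left, subst pos_less_divide_eq)
       (simp_all only: of_nat_0_less_iff mult.commute, simp)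
  with easy half \<open>0 < L\<close> show False
    by (intro play_not_easy[of b r _ _ "Suc r" L ?\<delta>]) (auto intro: mult_left_le_one_le)
qed


section \<open>From protocol trees to rounds\<close>

fun swap_player :: "player \<times> bool \<Rightarrow> player \<times> bool" where
  "swap_player (Alice, b) = (Bob, b)"
| "swap_player (Bob, b) = (Alice, b)"

text \<open>Exchanging the players reduces everything to protocols in which Bob speaks
  first.\<close>

primrec dual :: "('x, 'y, 'z) protocol \<Rightarrow> ('y, 'x, 'z) protocol" where
  "dual (Output z) = Output z"
| "dual (Send_Alice q P0 P1) = Send_Bob q (dual P0) (dual P1)"
| "dual (Send_Bob q P0 P1) = Send_Alice q (dual P0) (dual P1)"

lemma output_dual [simp]: "protocol_output (dual P) y x = protocol_output P x y"
  by (induction P) auto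

lemma transcript_dual: "transcript (dual P) y x = map swap_player (transcript P x y)"
  by (induction P) auto

lemma dual_neq_Send_Alice:
  "(\<And>q P0 P1. P \<noteq> Send_Bob q P0 P1) \<Longrightarrow> dual P \<noteq> Send_Alice q' P0' P1'"
  by (cases P) auto

definition bounded_rounds :: "nat \<Rightarrow> nat \<Rightarrow> (player \<times> bool) list \<Rightarrow> bool" where
  "bounded_rounds r b ms \<longleftrightarrow> length (rounds ms) \<le> r \<and> (\<forall>\<rho>\<in>set (rounds ms). length \<rho> \<le> b)"

lemma fst_swap_player_eq: "fst (swap_player m) = fst (swap_player m') \<longleftrightarrow> fst m = fst m'"
  by (cases m rule: swap_player.cases; cases m' rule: swap_player.cases) auto

lemma rounds_map_swap_player: "rounds (map swap_player ms) = map (map swap_player) (rounds ms)"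
  by (induction ms rule: rounds.induct)
     (simp_all add: takeWhile_map dropWhile_map comp_def fst_swap_player_eq)

lemma bounded_rounds_dual [simp]:
  "bounded_rounds r b (transcript (dual P) y x) \<longleftrightarrow> bounded_rounds r b (transcript P x y)"
  by (simp add: bounded_rounds_def transcript_dual rounds_map_swap_player)

text \<open>Until Alice first speaks, Bob's bits depend on \<open>y\<close> alone, so his whole
  opening round is a single message; \<open>bob_rest\<close> is the protocol vertex to which it
  leads.\<close>

primrec bob_msg :: "('x, 'y, 'z) protocol \<Rightarrow> 'y \<Rightarrow> bool list" where
  "bob_msg (Output z) y = []"
| "bob_msg (Send_Alice q P0 P1) y = []"
| "bob_msg (Send_Bob q P0 P1) y = q y # (if q y then bob_msg P1 y else bob_msg P0 y)"

primrec bob_rest :: "('x, 'y, 'z) protocol \<Rightarrow> 'y \<Rightarrow> ('x, 'y, 'z) protocol" where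
  "bob_rest (Output z) y = Output z"
| "bob_rest (Send_Alice q P0 P1) y = Send_Alice q P0 P1"
| "bob_rest (Send_Bob q P0 P1) y = (if q y then bob_rest P1 y else bob_rest P0 y)"

lemma transcript_bob_rest:
  "transcript P x y = map (Pair Bob) (bob_msg P y) @ transcript (bob_rest P y) x y"
  by (induction P) auto

lemma output_bob_rest: "protocol_output P x y = protocol_output (bob_rest P y) x y"
  by (induction P) auto

text \<open>The message spells the path through the protocol tree to the end of the round.\<close>

lemma bob_rest_cong: "bob_msg P y = bob_msg P y' \<Longrightarrow> bob_rest P y = bob_rest P y'"
  by (induction P) (auto split: if_splits)

lemma bob_rest_neq_Send_Bob: "bob_rest P y \<noteq> Send_Bob q' P0' P1'"
  by (induction P) auto

lemma rounds_append:
  assumes "bs \<noteq> []" "\<And>m ms'. ms = m # ms' \<Longrightarrow> fst m \<noteq> p"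
  shows "rounds (map (Pair p) bs @ ms) = map (Pair p) bs # rounds ms"
proof -
  obtain c cs where bs: "bs = c # cs"
    using assms(1) by (cases bs) auto
  have "takeWhile (\<lambda>m'. fst m' = p) ms = []" "dropWhile (\<lambda>m'. fst m' = p) ms = ms"
    using assms(2) by (cases ms; auto)+
  then show ?thesis
    by (simp add: bs takeWhile_append dropWhile_append)
qed

lemma rounds_Send_Bob:
  "rounds (transcript (Send_Bob q P0 P1) x y) =
     map (Pair Bob) (bob_msg (Send_Bob q P0 P1) y)
       # rounds (transcript (bob_rest (Send_Bob q P0 P1) y) x y)"
proof -
  have *: "fst m \<noteq> Bob" if "transcript Q x y = m # ms" "\<And>q P0 P1. Q \<noteq> Send_Bob q P0 P1"
    for Q m ms
    using that by (cases Q) auto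
  have "rounds (map (Pair Bob) (bob_msg (Send_Bob q P0 P1) y)
        @ transcript (bob_rest (Send_Bob q P0 P1) y) x y)
      = map (Pair Bob) (bob_msg (Send_Bob q P0 P1) y)
        # rounds (transcript (bob_rest (Send_Bob q P0 P1) y) x y)"
  proof (rule rounds_append)
    show "fst m \<noteq> Bob" if "transcript (bob_rest (Send_Bob q P0 P1) y) x y = m # ms'" for m ms'
      by (rule *[OF that bob_rest_neq_Send_Bob])
  qed simp
  then show ?thesis
    by (simp only: transcript_bob_rest[of "Send_Bob q P0 P1"])
qed

text \<open>Bob's opening round becomes one message of \<open>easy\<close>. Alice speaks next, so
  the dual of the remaining protocol again has its second player speaking first.\<close>

lemma easy_protocol_output:
  assumes "\<And>q P0 P1. P \<noteq> Send_Alice q P0 P1"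
    and "\<And>x y. x \<in> X \<Longrightarrow> y \<in> Y \<Longrightarrow> bounded_rounds r b (transcript P x y)"
  shows "easy b r X Y (protocol_output P)"
  using assms
proof (induction r arbitrary: P X Y)
  case 0
  have "X = {} \<or> Y = {}" if "P = Send_Bob q P0 P1" for q P0 P1
    using 0(2) unfolding that by (auto simp: bounded_rounds_def)
  with 0(1) show ?case
    by (cases P) auto
next
  case (Suc r)
  \<comment> \<open>An empty \<open>X\<close> is split off because the hypothesis then says nothing
    about the length of Bob's messages.\<close>
  consider (trivial) "(\<exists>z. P = Output z) \<or> X = {}"
    | (speaks) q P0 P1 x0 where "P = Send_Bob q P0 P1" "x0 \<in> X"
    using Suc.prems(1) by (cases P) auto
  then show ?case
  proof cases
    case trivial
    then obtain z where "\<And>x y. x \<in> X \<Longrightarrow> protocol_output P x y = z"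
      by auto
    then show ?thesis
      by (intro easy_const)
  next
    case (speaks q P0 P1 x0)
    note P = \<open>P = Send_Bob q P0 P1\<close> and x0 = \<open>x0 \<in> X\<close>
    have rounds: "rounds (transcript P x y)
        = map (Pair Bob) (bob_msg P y) # rounds (transcript (bob_rest P y) x y)" for x y
      unfolding P by (rule rounds_Send_Bob)
    have "length (bob_msg P y) \<le> b" if "y \<in> Y" for y
      using Suc.prems(2)[OF x0 that] by (simp add: bounded_rounds_def rounds)
    moreover have "easy b r {y \<in> Y. bob_msg P y = m} X (\<lambda>y x. protocol_output P x y)" for m
    proof (cases "{y \<in> Y. bob_msg P y = m} = {}")
      case True
      show ?thesis
        unfolding True by (rule easy_const) simp
    next
      case False
      then obtain y0 where "bob_msg P y0 = m"
        by blast
      then have Q: "bob_rest P y = bob_rest P y0" if "bob_msg P y = m" for y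
        using that by (metis bob_rest_cong)
      have "easy b r {y \<in> Y. bob_msg P y = m} X (protocol_output (dual (bob_rest P y0)))"
      proof (rule Suc.IH)
        show "dual (bob_rest P y0) \<noteq> Send_Alice q P0 P1" for q P0 P1
          by (intro dual_neq_Send_Alice bob_rest_neq_Send_Bob)
        show "bounded_rounds r b (transcript (dual (bob_rest P y0)) y x)"
          if "y \<in> {y \<in> Y. bob_msg P y = m}" "x \<in> X" for y x
          unfolding bounded_rounds_dual
          using Suc.prems(2)[of x y] that Q[of y] by (auto simp: bounded_rounds_def rounds)
      qed
      then show ?thesis
        by (rule easy_pullback[where \<phi> = id and \<psi> = id and h = id])
           (auto simp: output_bob_rest[of P] Q)
    qed
    ultimately show ?thesis
      by auto
  qed
qed


section \<open>Embedding the pointer game into the Strategy problem\<close>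

text \<open>
  A vertex of the pointer game becomes a block of \<^verbatim>\<open>2 * L + 1\<close> binary levels, at which its owner
  spells the pointer at the even relative depths while the other player always turns left. As the
  length of a block is odd, the next block starts with the other player.
\<close>

definition evens :: "nat \<Rightarrow> bool list \<Rightarrow> bool list" where
  "evens L w = map (\<lambda>j. w ! (2 * j)) [0..<Suc L]"

definition block :: "nat \<Rightarrow> bool list \<Rightarrow> bool list" where
  "block L p = map (\<lambda>j. even j \<and> p ! (j div 2)) [0..<2 * L + 1]"

text \<open>A strategy on all vertices, regardless of who controls them; \<open>weave\<close> later
  selects by parity, so the recursion need not track the roles.\<close>

primrec strat :: "input \<Rightarrow> nat \<Rightarrow> bool list \<Rightarrow> bool" where
  "strat Leaf L v = False"
| "strat (Node p c) L v =
     (if length v < 2 * L + 1 then p ! (length v div 2)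
      else strat (c (evens L (take (2 * L + 1) v))) L (drop (2 * L + 1) v))"

definition weave :: "nat \<Rightarrow> input \<Rightarrow> input \<Rightarrow> bool list \<Rightarrow> bool" where
  "weave L x y v = (if even (length v) then strat x L v else strat y L v)"

primrec decode :: "nat \<Rightarrow> nat \<Rightarrow> bool list \<Rightarrow> bool list list" where
  "decode L 0 w = []"
| "decode L (Suc k) w = evens L (take (2 * L + 1) w) # decode L k (drop (2 * L + 1) w)"

lemma length_block [simp]: "length (block L p) = 2 * L + 1"
  by (simp add: block_def)

lemma evens_block: "p \<in> index L \<Longrightarrow> evens L (block L p) = p"
  by (intro nth_equalityI)
     (auto simp: evens_def block_def index_def nth_append simp del: upt_Suc)

lemma length_walk [simp]: "length (walk f d) = d"
  by (induction d) auto

lemma walk_add: "walk f (m + n) = walk f m @ walk (\<lambda>v. f (walk f m @ v)) n"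
  by (induction n) auto

lemma walk_weave_block:
  assumes "t \<le> 2 * L + 1"
  shows "walk (weave L (Node p c) (Node (replicate (Suc L) False) c')) t
    = map (\<lambda>j. even j \<and> p ! (j div 2)) [0..<t]"
  using assms
proof (induction t)
  case (Suc t)
  let ?f = "weave L (Node p c) (Node (replicate (Suc L) False) c')"
  have "t div 2 < Suc L"
    using Suc.prems by linarith
  then have "replicate (Suc L) False ! (t div 2) = False"
    by (rule nth_replicate)
  then have "?f (walk ?f t) = (even t \<and> p ! (t div 2))"
    using Suc.prems by (auto simp: weave_def simp del: replicate_Suc)
  with Suc show ?case
    by (simp del: replicate_Suc)
qed simp

text \<open>Each block of the walk spells one pointer of the play. Levels below the \<open>k\<close>
  blocks are ignored by \<open>decode\<close>, so \<open>d\<close> may exceed the height of the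
  embedded game.\<close>

lemma decode_walk_weave:
  assumes "k * (2 * L + 1) \<le> d" "x \<in> owner_inputs L k" "y \<in> other_inputs L k"
  shows "decode L k (walk (weave L x y) d) = play k x y"
  using assms
proof (induction k arbitrary: d x y)
  case (Suc k)
  obtain p c c' where x: "x = Node p c" and y: "y = Node (replicate (Suc L) False) c'"
    and p: "p \<in> index L" and "c \<in> index L \<rightarrow>\<^sub>E other_inputs L k"
    and "c' \<in> index L \<rightarrow>\<^sub>E owner_inputs L k"
    using Suc.prems by auto
  then have c: "c p \<in> other_inputs L k" "c' p \<in> owner_inputs L k"
    by auto
  obtain d' where d: "d = (2 * L + 1) + d'"
    using Suc.prems(1) le_Suc_ex[of "2 * L + 1" d] by auto
  have "walk (weave L x y) (2 * L + 1) = block L p"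
    unfolding x y block_def by (rule walk_weave_block) simp
  \<comment> \<open>The odd block length flips parities, so the two subtree inputs trade places just
    as in \<open>play\<close>.\<close>
  moreover have "(\<lambda>v. weave L x y (block L p @ v)) = weave L (c' p) (c p)"
    using p by (auto simp: fun_eq_iff weave_def x y evens_block)
  ultimately have "walk (weave L x y) d = block L p @ walk (weave L (c' p) (c p)) d'"
    unfolding d walk_add by simp
  then show ?case
    using Suc.prems(1) Suc.IH[of d' "c' p" "c p"] c p by (simp add: d x y evens_block)
qed simp

text \<open>The game bound applies when the player who does not own the root speaks first. If Alice
  starts, the game is placed at the root, which is Bob's. Otherwise the root always turns left and
  the game starts at depth 1, which is Alice's; this costs the extra level in the bound on
  \<open>d\<close>.\<close>

theorem no_strategy_protocol:
  assumes solves: "solves_strategy d P"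
    and bounded: "\<And>f. length (strategy_rounds d P f) \<le> r"
      "\<And>f \<rho>. \<rho> \<in> set (strategy_rounds d P f) \<Longrightarrow> length \<rho> \<le> b"
    and L: "4 * (r + 1)\<^sup>2 * (b + 2) < 2 ^ Suc L"
    and d: "(r + 1) * (2 * L + 1) + 1 \<le> d"
  shows False
proof -
  let ?X = "owner_inputs L (Suc r)" and ?Y = "other_inputs L (Suc r)"
  \<comment> \<open>Leaf indices are distinct, so the output determines the whole walk.\<close>
  let ?leaf = "inv_into {v. length v = d} leaf_index"
  have leaf: "?leaf (reached_index d f) = walk f d" for f
    using bij_betw_inv_into_left[OF bij_betw_leaf_index[of d]] by (simp add: reached_index_def)
  have out_eq: "protocol_output P (alice_view d f) (bob_view d f) = reached_index d f" for f
    using solves by (simp add: solves_strategy_def)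
  have rounds: "bounded_rounds r b (transcript P (alice_view d f) (bob_view d f))" for f
    using bounded by (simp add: bounded_rounds_def strategy_rounds_def)
  have not_easy: "\<not> easy b r ?X ?Y (play (Suc r))"
    using L by (rule game_not_easy)
  show False
  proof (cases "\<exists>q P0 P1. P = Send_Alice q P0 P1")
    case True
    define \<phi> where "\<phi> x = bob_view d (strat x L)" for x
    define \<psi> where "\<psi> y = alice_view d (strat y L)" for y
    \<comment> \<open>Each view of the combined function depends on only one game input, so the
      players can compute their views separately.\<close>
    have views: "\<phi> x = bob_view d (weave L x y)" "\<psi> y = alice_view d (weave L x y)" for x y
      by (auto simp: \<phi>_def \<psi>_def bob_view_def alice_view_def weave_def restrict_def)
    have "easy b r (\<phi> ` ?X) (\<psi> ` ?Y) (protocol_output (dual P))"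
    proof (rule easy_protocol_output)
      show "dual P \<noteq> Send_Alice q P0 P1" for q P0 P1
        using True by (intro dual_neq_Send_Alice) auto
      show "bounded_rounds r b (transcript (dual P) x y)"
        if "x \<in> \<phi> ` ?X" "y \<in> \<psi> ` ?Y" for x y
        using that rounds views by auto metis
    qed
    then have "easy b r ?X ?Y (play (Suc r))"
    proof (rule easy_pullback[where h = "decode L (Suc r) \<circ> ?leaf"])
      show "play (Suc r) x y
          = (decode L (Suc r) \<circ> ?leaf) (protocol_output (dual P) (\<phi> x) (\<psi> y))"
        if "x \<in> ?X" "y \<in> ?Y" for x y
        using decode_walk_weave[of "Suc r" L d x y] that d
        by (simp only: output_dual views[where x = x and y = y] out_eq leaf comp_apply) simp
    qed auto
    with not_easy show False ..
  next
    case False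
    define \<phi> where "\<phi> x = alice_view d (\<lambda>v. strat x L (tl v))" for x
    define \<psi> where "\<psi> y = bob_view d (\<lambda>v. v \<noteq> [] \<and> strat y L (tl v))" for y
    define f where "f x y = (\<lambda>v. v \<noteq> [] \<and> weave L x y (tl v))" for x y
    have views: "\<phi> x = alice_view d (f x y)" "\<psi> y = bob_view d (f x y)" for x y
      by (auto simp: \<phi>_def \<psi>_def f_def bob_view_def alice_view_def weave_def restrict_def)
    obtain d' where d': "d = 1 + d'"
      using d le_Suc_ex[of 1 d] by auto
    have walk: "walk (f x y) d = False # walk (weave L x y) d'" for x y
      unfolding d' walk_add by (simp add: f_def)
    have "easy b r (\<phi> ` ?X) (\<psi> ` ?Y) (protocol_output P)"
    proof (rule easy_protocol_output)
      show "P \<noteq> Send_Alice q P0 P1" for q P0 P1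
        using False by auto
      show "bounded_rounds r b (transcript P x y)"
        if "x \<in> \<phi> ` ?X" "y \<in> \<psi> ` ?Y" for x y
        using that rounds views by auto metis
    qed
    then have "easy b r ?X ?Y (play (Suc r))"
    proof (rule easy_pullback[where h = "\<lambda>n. decode L (Suc r) (tl (?leaf n))"])
      show "play (Suc r) x y
          = decode L (Suc r) (tl (?leaf (protocol_output P (\<phi> x) (\<psi> y))))"
        if "x \<in> ?X" "y \<in> ?Y" for x y
        using decode_walk_weave[of "Suc r" L d' x y] that d
        by (simp only: views[where x = x and y = y] out_eq leaf walk) (simp add: d')
    qed auto
    with not_easy show False ..
  qed
qed


section \<open>Asymptotics\<close>

lemma filterlim_tree_size: "filterlim tree_size at_top sequentially"
proof (rule filterlim_at_top_mono[OF filterlim_ident])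
  have "n \<le> tree_size n" for n
    using less_exp[of "n + 1"] unfolding tree_size_eq by linarith
  then show "\<forall>\<^sub>F n in sequentially. n \<le> tree_size n"
    by simp
qed

lemma log_tree_size_bounds: "real d \<le> log 2 (tree_size d)" "log 2 (tree_size d) \<le> d + 1"
proof -
  have size: "2 ^ d \<le> tree_size d" "tree_size d \<le> 2 ^ (d + 1)"
    using one_le_power[of "2 :: nat" d] by (auto simp: tree_size_eq)
  then have "0 < tree_size d"
    using zero_less_power[of "2 :: nat" d] by linarith
  with size show "real d \<le> log 2 (tree_size d)" "log 2 (tree_size d) \<le> d + 1"
    using le_log2_of_power log2_of_power_le by blast+
qed

theorem theorem3:
  fixes \<epsilon> :: real
  assumes "\<epsilon> > 0"
  shows "\<not> (\<exists>(P :: nat \<Rightarrow> strategy_protocol) (r :: nat \<Rightarrow> nat) (b :: nat \<Rightarrow> nat).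
           (\<lambda>n. real (r n)) \<in> O(\<lambda>n. log 2 (real n) powr (1 - \<epsilon>)) \<and>
           (\<lambda>n. real (b n)) \<in> O(\<lambda>n. log 2 (real n)) \<and>
           (\<forall>d. solves_strategy d (P d) \<and>
                (\<forall>f. length (strategy_rounds d (P d) f) \<le> r (tree_size d) \<and>
                     (\<forall>\<rho>\<in>set (strategy_rounds d (P d) f). length \<rho> \<le> b (tree_size d)))))"
proof (intro notI, elim exE conjE)
  fix P :: "nat \<Rightarrow> strategy_protocol" and r b :: "nat \<Rightarrow> nat"
  assume r: "(\<lambda>n. real (r n)) \<in> O(\<lambda>n. log 2 (real n) powr (1 - \<epsilon>))"
    and b: "(\<lambda>n. real (b n)) \<in> O(\<lambda>n. log 2 (real n))"
    and P: "\<forall>d. solves_strategy d (P d) \<and>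
                (\<forall>f. length (strategy_rounds d (P d) f) \<le> r (tree_size d) \<and>
                     (\<forall>\<rho>\<in>set (strategy_rounds d (P d) f). length \<rho> \<le> b (tree_size d)))"
  obtain C where C: "C > 0"
    "\<forall>\<^sub>F n in at_top. norm (real (r n)) \<le> C * norm (log 2 (real n) powr (1 - \<epsilon>))"
    using r by (rule landau_o.bigE)
  obtain D where D: "D > 0" "\<forall>\<^sub>F n in at_top. norm (real (b n)) \<le> D * norm (log 2 (real n))"
    using b by (rule landau_o.bigE)
  \<comment> \<open>Shrinking \<epsilon> below 1 keeps the exponent \<open>1 - e\<close> positive,
    so that the logarithm may be replaced by its upper bound \<open>d + 1\<close>.\<close>
  define e where "e = min \<epsilon> (1/2)"
  have e: "0 < e" "e < 1" "e \<le> \<epsilon>"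
    using assms by (auto simp: e_def)
  let ?r = "\<lambda>d::nat. C * (real d + 1) powr (1 - e)"
  let ?b = "\<lambda>d::nat. D * (real d + 1)"
  have rb: "\<forall>\<^sub>F d in sequentially. real (r (tree_size d)) \<le> ?r d \<and> real (b (tree_size d)) \<le> ?b d"
    using eventually_compose_filterlim[OF C(2) filterlim_tree_size]
      eventually_compose_filterlim[OF D(2) filterlim_tree_size] eventually_ge_at_top[of 1]
  proof eventually_elim
    case (elim d)
    let ?l = "log 2 (tree_size d)"
    have l: "1 \<le> ?l" "?l \<le> d + 1"
      using log_tree_size_bounds[of d] elim(3) by linarith+
    have "?l powr (1 - \<epsilon>) \<le> ?l powr (1 - e)"
      using l e by (intro powr_mono) auto
    also have "\<dots> \<le> (real d + 1) powr (1 - e)"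
      using l e by (intro powr_mono2) auto
    finally have "C * ?l powr (1 - \<epsilon>) \<le> ?r d"
      using C(1) by simp
    moreover have "D * ?l \<le> ?b d"
      using D(1) l by simp
    ultimately show ?case
      using elim l by simp
  qed
  \<comment> \<open>The left side has order \<open>d\<close> to the power \<open>3 - 2 * e\<close>,
    which is below the degree \<open>d ^ 4\<close> aimed at. Blocks then have logarithmic length, so
    the total depth is of order \<open>d powr (1 - e)\<close> times \<open>log 2 d\<close>, which is
    o(d).\<close>
  have width: "\<forall>\<^sub>F d in sequentially. 4 * (?r d + 1)\<^sup>2 * (?b d + 2) < real d ^ 4"
    using C(1) D(1) e by real_asymp
  have depth: "\<forall>\<^sub>F d in sequentially. (?r d + 1) * (2 * (4 * log 2 (real d) + 1) + 1) + 1 \<le> real d"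
    using C(1) e by real_asymp
  have "\<forall>\<^sub>F d in sequentially. False"
    using rb width depth eventually_ge_at_top[of 1]
  proof eventually_elim
    case (elim d)
    let ?R = "r (tree_size d)" and ?B = "b (tree_size d)"
    \<comment> \<open>The least natural number \<open>L\<close> for which \<open>2 ^ L\<close> is at
      least \<open>d ^ 4\<close>.\<close>
    define L where "L = nat \<lceil>4 * log 2 (real d)\<rceil>"
    have "0 \<le> log 2 (real d)"
      using elim(4) by simp
    then have L: "4 * log 2 (real d) \<le> L" "L \<le> 4 * log 2 (real d) + 1"
      by (auto simp: L_def)
    have "real d ^ 4 = (2 powr log 2 (real d)) powr 4"
      using elim(4) by simp
    also have "\<dots> = 2 powr (4 * log 2 (real d))"
      by (simp only: powr_powr mult.commute)
    also have "\<dots> \<le> 2 powr real L"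
      using L by simp
    also have "\<dots> \<le> 2 ^ Suc L"
      by (simp add: powr_realpow)
    finally have dL: "real d ^ 4 \<le> 2 ^ Suc L" .
    have "4 * (real ?R + 1)\<^sup>2 * (real ?B + 2) \<le> 4 * (?r d + 1)\<^sup>2 * (?b d + 2)"
      using elim(1) by (intro mult_mono power_mono) auto
    also have "\<dots> < 2 ^ Suc L"
      using elim(2) dL by linarith
    finally have "real (4 * (?R + 1)\<^sup>2 * (?B + 2)) < real (2 ^ Suc L)"
      by (simp only: of_nat_mult of_nat_power of_nat_add of_nat_numeral of_nat_1)
    then have width: "4 * (?R + 1)\<^sup>2 * (?B + 2) < 2 ^ Suc L"
      by (simp only: of_nat_less_iff)
    have "(real ?R + 1) * (2 * real L + 1) + 1 \<le> (?r d + 1) * (2 * (4 * log 2 (real d) + 1) + 1) + 1"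
      using elim(1) L by (intro add_mono mult_mono) auto
    also have "\<dots> \<le> real d"
      by (rule elim(3))
    finally have "real ((?R + 1) * (2 * L + 1) + 1) \<le> real d"
      by (simp only: of_nat_mult of_nat_add of_nat_numeral of_nat_1)
    then have depth: "(?R + 1) * (2 * L + 1) + 1 \<le> d"
      by (simp only: of_nat_le_iff)
    show ?case
      using P by (intro no_strategy_protocol[OF _ _ _ width depth, of "P d"]) auto
  qed
  then show False
    by simp
qed

end
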